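(* Consider a red--black harmonic two--grid configuration (as defined in the context) in which $A$, $\bar{A}$, $\bar{F}_R$, $\widetilde{A}$ and $\widetilde{F}_I$ are non-singular. The multiplicative two--grid scheme works as a direct solver, i.e. for every $f\in\mathbb{C}^n$ its output $v$ equals the solution $u$ of $Au=f$, if and only if $$\bar{\Pi}_{R,L}\,\Lambda_L\,\widetilde{\Pi}_{I,L} = \bar{\Pi}_{R,H}\,\Lambda_H\,\widetilde{\Pi}_{I,H}.$$
   Context: Let $n$ be even. $X^H$ is the conjugate transpose. A red--black partition splits $\{1,\dots,n\}$ into red nodes and black nodes, $n/2$ of each. The red down-sampling matrix $\bar{D}\in\{0,1\}^{\frac n2\times n}$ has $(\bar D)_{i,j}=1$ iff $j$ is the $i$-th red node; the black one $\widetilde{D}\in\{0,1\}^{\frac n2\times n}$ has $(\widetilde D)_{i,j}=1$ iff $j$ is the $i$-th black node. The up-sampling matrices are $\bar U=\bar D^T$, $\widetilde U=\widetilde D^T$. A matrix $A\in\mathbb{C}^{n\times n}$ has red--black harmonic aliasing patterns if it is diagonalizable, $A=W\Lambda V^H$ with $\Lambda$ diagonal and $V^HW=I$, and for some red--black partition $$V^H\bar U\bar D W=\tfrac12\begin{bmatrix} I & I \\ I & I \end{bmatrix},\qquad V^H\widetilde U\widetilde D W=\tfrac12\begin{bmatrix} I & -I \\ -I & I \end{bmatrix}$$ (blocks of size $n/2$). A red--black harmonic two--grid configuration consists of such an $A$ with fixed $W$, $V$, $\Lambda$ and partition, together with four inter-grid filters, i.e. matrices diagonalized by the same basis: $\bar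 F_R=W\bar\Pi_RV^H$, $\bar F_I=W\bar\Pi_IV^H$, $\widetilde F_R=W\widetilde\Pi_RV^H$, $\widetilde F_I=W\widetilde\Pi_IV^H$ with diagonal $\bar\Pi_R,\bar\Pi_I,\widetilde\Pi_R,\widetilde\Pi_I$. Each $n\times n$ diagonal matrix $E$ of eigenvalues is split into two $\frac n2\times\frac n2$ diagonal blocks $E=\mathrm{diag}(E_L,E_H)$; this gives $\Lambda_L,\Lambda_H$, $\bar\Pi_{R,L},\bar\Pi_{R,H}$, $\widetilde\Pi_{I,L},\widetilde\Pi_{I,H}$, etc. Restriction and interpolation operators: $\bar I_R=\bar D\bar F_R$, $\bar I_I=\bar F_I\bar U$, $\widetilde I_R=\widetilde D\widetilde F_R$, $\widetilde I_I=\widetilde F_I\widetilde U$. Coarse system matrices: $\bar A=\bar I_RA\bar I_I$, $\widetilde A=\widetilde I_RA\widetilde I_I$. Multiplicative two--grid scheme for $Au=f$: compute $v_0=\bar I_I\bar A^{-1}\bar I_Rf$ (nested iteration on the red grid), then $v=v_0+\widetilde I_I\widetilde A^{-1}\widetilde I_R(f-Av_0)$ (correction scheme on the black grid); the output is $v$. *)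

theory Defs
  imports "Jordan_Normal_Form.Schur_Decomposition"
begin

(* Nodes are numbered 0, ..., n - 1. *)

definition red_black_partition :: "nat \<Rightarrow> nat set \<Rightarrow> nat set \<Rightarrow> bool" where
  "red_black_partition n R B \<longleftrightarrow>
     R \<union> B = {0..<n} \<and> R \<inter> B = {} \<and> card R = n div 2 \<and> card B = n div 2"

(* The i-th node of S is taken with respect to the increasing order of the nodes. *)
definition down_sampling :: "nat \<Rightarrow> nat set \<Rightarrow> complex mat" where
  "down_sampling n S =
     mat (n div 2) n (\<lambda>(i, j). if j = sorted_list_of_set S ! i then 1 else 0)"

definition up_sampling :: "nat \<Rightarrow> nat set \<Rightarrow> complex mat" where
  "up_sampling n S = transpose_mat (down_sampling n S)"

definition diagonalized_by ::
    "nat \<Rightarrow> complex mat \<Rightarrow> complex mat \<Rightarrow> complex mat \<Rightarrow> complex mat \<Rightarrow> bool" where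
  "diagonalized_by n W V E M \<longleftrightarrow>
     E \<in> carrier_mat n n \<and> diagonal_mat E \<and> M = W * E * mat_adjoint V"

definition harmonic_aliasing ::
    "nat \<Rightarrow> complex mat \<Rightarrow> complex mat \<Rightarrow> complex mat \<Rightarrow> complex mat \<Rightarrow>
     nat set \<Rightarrow> nat set \<Rightarrow> bool" where
  "harmonic_aliasing n A W V \<Lambda> R B \<longleftrightarrow>
     W \<in> carrier_mat n n \<and> V \<in> carrier_mat n n \<and> mat_adjoint V * W = 1\<^sub>m n \<and>
     diagonalized_by n W V \<Lambda> A \<and>
     red_black_partition n R B \<and>
     (let I = 1\<^sub>m (n div 2) in
        mat_adjoint V * up_sampling n R * down_sampling n R * W =
          (1 / 2) \<cdot>\<^sub>m four_block_mat I I I I \<and>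
        mat_adjoint V * up_sampling n B * down_sampling n B * W =
          (1 / 2) \<cdot>\<^sub>m four_block_mat I (- I) (- I) I)"

definition low_block :: "nat \<Rightarrow> complex mat \<Rightarrow> complex mat" where
  "low_block n E = mat (n div 2) (n div 2) (\<lambda>(i, j). E $$ (i, j))"

definition high_block :: "nat \<Rightarrow> complex mat \<Rightarrow> complex mat" where
  "high_block n E = mat (n div 2) (n div 2) (\<lambda>(i, j). E $$ (n div 2 + i, n div 2 + j))"

definition restriction_op :: "nat \<Rightarrow> nat set \<Rightarrow> complex mat \<Rightarrow> complex mat" where
  "restriction_op n S F = down_sampling n S * F"

definition interpolation_op :: "nat \<Rightarrow> nat set \<Rightarrow> complex mat \<Rightarrow> complex mat" where
  "interpolation_op n S F = F * up_sampling n S"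

definition coarse_mat ::
    "nat \<Rightarrow> nat set \<Rightarrow> complex mat \<Rightarrow> complex mat \<Rightarrow> complex mat \<Rightarrow> complex mat" where
  "coarse_mat n S A F\<^sub>R F\<^sub>I = restriction_op n S F\<^sub>R * A * interpolation_op n S F\<^sub>I"

(* One coarse-grid solve; unspecified when the coarse system matrix is singular. *)
definition coarse_solve ::
    "nat \<Rightarrow> nat set \<Rightarrow> complex mat \<Rightarrow> complex mat \<Rightarrow> complex mat \<Rightarrow> complex vec \<Rightarrow> complex vec" where
  "coarse_solve n S A F\<^sub>R F\<^sub>I r =
     interpolation_op n S F\<^sub>I *\<^sub>v
       (the (mat_inverse (coarse_mat n S A F\<^sub>R F\<^sub>I)) *\<^sub>v (restriction_op n S F\<^sub>R *\<^sub>v r))"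

definition multiplicative_two_grid ::
    "nat \<Rightarrow> complex mat \<Rightarrow> nat set \<Rightarrow> complex mat \<Rightarrow> complex mat \<Rightarrow>
     nat set \<Rightarrow> complex mat \<Rightarrow> complex mat \<Rightarrow> complex vec \<Rightarrow> complex vec" where
  "multiplicative_two_grid n A R FR\<^sub>R FR\<^sub>I B FB\<^sub>R FB\<^sub>I f =
     (let v\<^sub>0 = coarse_solve n R A FR\<^sub>R FR\<^sub>I f
      in v\<^sub>0 + coarse_solve n B A FB\<^sub>R FB\<^sub>I (f - A *\<^sub>v v\<^sub>0))"

end

(* The red step leaves an error in the kernel of D_r F_R A, where D_r, U_r and D_b, U_b are the red
   and black sampling matrices, and the black step annihilates exactly the range of F_I U_b. Both
   spaces have dimension n/2, so the scheme is exact iff D_r F_R A F_I U_b = 0. Multiplying by V^H U_r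
   on the left and D_b W on the right, both injective operations, turns this into
   [I I; I I] diag(L, H) [I -I; -I I] = 0 for the diagonal blocks L, H of the product of the
   eigenvalue matrices, i.e. L = H. *)

theory Submission
  imports Defs
begin

section \<open>Matrix products by dimension, and inverses of square matrices\<close>

lemma mult_mat_assoc_dims:
  fixes A B C :: "'a::semiring_0 mat"
  assumes "dim_col A = dim_row B" "dim_col B = dim_row C"
  shows "A * B * C = A * (B * C)"
  by (rule assoc_mult_mat[of A "dim_row A" "dim_row B" B "dim_row C" C "dim_col C"])
     (use assms in auto)

lemma mult_mat_vec_assoc_dims:
  fixes A B :: "'a::semiring_0 mat"
  assumes "dim_col A = dim_row B" "dim_col B = dim_vec v"
  shows "A * B *\<^sub>v v = A *\<^sub>v (B *\<^sub>v v)"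
  by (rule assoc_mult_mat_vec[of A "dim_row A" "dim_row B" B "dim_vec v" v])
     (use assms in \<open>auto intro: carrier_vecI\<close>)

(* Matching dimensions of explicit factors are found by evaluating dim_row and dim_col, whereas the
   carrier premises of the library rules leave the inner dimensions to be guessed. *)
declare assoc_mult_mat [simp del] assoc_mult_mat_vec [simp del]

lemma eq_mat_one_iff_mult_vec:
  fixes T :: "'a::comm_ring_1 mat"
  assumes T: "T \<in> carrier_mat n n"
  shows "T = 1\<^sub>m n \<longleftrightarrow> (\<forall>u\<in>carrier_vec n. T *\<^sub>v u = u)"
proof
  assume "\<forall>u\<in>carrier_vec n. T *\<^sub>v u = u"
  then have unit: "(T *\<^sub>v unit_vec n j) $ i = unit_vec n j $ i" for i j
    by simp
  have "T $$ (i, j) = unit_vec n j $ i" if "i < n" "j < n" for i j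
    using unit[of j i] T that by (simp add: scalar_prod_right_unit)
  then show "T = 1\<^sub>m n"
    using T by (intro eq_matI) (auto simp: unit_vec_def)
qed (use T in simp)

lemma invertible_mat_obtain_inverse:
  fixes A :: "'a::field mat"
  assumes "invertible_mat A" "A \<in> carrier_mat n n"
  obtains C where "C \<in> carrier_mat n n" "A * C = 1\<^sub>m n" "C * A = 1\<^sub>m n"
proof -
  from assms(1) obtain C where C: "A * C = 1\<^sub>m (dim_row A)" "C * A = 1\<^sub>m (dim_row C)"
    unfolding invertible_mat_def inverts_mat_def by blast
  \<comment> \<open>\<open>inverts_mat\<close> leaves the shape of \<open>C\<close> open; comparing
    the column counts in both equations shows that \<open>C\<close> is square of size
    \<open>n\<close>.\<close>
  have "dim_row C = n" "dim_col C = n"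
    using arg_cong[OF C(1), of dim_col] arg_cong[OF C(2), of dim_col] assms(2) by auto
  then show thesis
    using that[of C] C assms(2) by auto
qed

text \<open>\<open>mat_inverse\<close> is characterized through \<open>Units\<close> of
  \<open>ring_mat\<close>, so invertibility is first moved there. This rules out
  \<open>None\<close>, for which \<open>the\<close> would be unspecified.\<close>

lemma mat_inverse_invertible:
  fixes A :: "'a::field mat"
  assumes "invertible_mat A" and A: "A \<in> carrier_mat n n"
  shows "the (mat_inverse A) \<in> carrier_mat n n" "the (mat_inverse A) * A = 1\<^sub>m n"
proof -
  obtain C where "C \<in> carrier_mat n n" "A * C = 1\<^sub>m n" "C * A = 1\<^sub>m n"
    using invertible_mat_obtain_inverse[OF assms] .
  then have "A \<in> Units (ring_mat TYPE('a) n ())"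
    using A by (auto simp: Units_def ring_mat_def)
  then obtain X where "mat_inverse A = Some X"
    using mat_inverse(1)[OF A, of "()"] by (cases "mat_inverse A") auto
  then show "the (mat_inverse A) \<in> carrier_mat n n" "the (mat_inverse A) * A = 1\<^sub>m n"
    using mat_inverse(2)[OF A] by auto
qed

section \<open>Sampling matrices\<close>

text \<open>The rows of the down-sampling matrix are unit vectors at distinct nodes of
  \<open>S\<close>, hence orthonormal. The cardinality keeps every index \<open>i < n div 2\<close>
  within the sorted list.\<close>

lemma down_up_sampling:
  assumes "S \<subseteq> {0..<n}" "card S = n div 2"
  shows "down_sampling n S * up_sampling n S = 1\<^sub>m (n div 2)"
proof -
  let ?s = "sorted_list_of_set S"
  have fin: "finite S" using assms(1) finite_subset by blast
  have len: "length ?s = n div 2" using assms(2) by simp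
  have in_range: "?s ! i < n" if "i < n div 2" for i
    using nth_mem[of i ?s] that len assms(1) fin by auto
  have inj: "?s ! i = ?s ! k \<longleftrightarrow> i = k" if "i < n div 2" "k < n div 2" for i k
    using that len by (simp add: nth_eq_iff_index_eq)
  show ?thesis
  proof (rule eq_matI)
    fix i k assume "i < dim_row (1\<^sub>m (n div 2) :: complex mat)"
      "k < dim_col (1\<^sub>m (n div 2) :: complex mat)"
    then have ik: "i < n div 2" "k < n div 2" by auto
    have "(down_sampling n S * up_sampling n S) $$ (i, k) =
        (\<Sum>j = 0..<n. (if j = ?s ! i then 1 else 0) * (if j = ?s ! k then 1 else 0))"
      using ik by (simp add: down_sampling_def up_sampling_def scalar_prod_def)
    also have "\<dots> = (\<Sum>j = 0..<n. if j = ?s ! i then (if ?s ! i = ?s ! k then 1 else 0) else 0)"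
      by (rule sum.cong) auto
    also have "\<dots> = (if i = k then 1 else 0)"
      using in_range[OF ik(1)] inj[OF ik] by simp
    finally show "(down_sampling n S * up_sampling n S) $$ (i, k) = 1\<^sub>m (n div 2) $$ (i, k)"
      using ik by simp
  qed (auto simp: down_sampling_def up_sampling_def)
qed

lemma down_sampling_carrier [simp]: "down_sampling n S \<in> carrier_mat (n div 2) n"
  by (simp add: down_sampling_def)

lemma up_sampling_carrier [simp]: "up_sampling n S \<in> carrier_mat n (n div 2)"
  by (simp add: up_sampling_def)

section \<open>Exactness of an abstract two-grid scheme\<close>

text \<open>Here \<open>X\<close> and \<open>Y\<close> stand for \<open>A\<close> followed by restriction on the two grids, and \<open>P\<close>, \<open>Q\<close> for
  the interpolations. The columns of \<open>N\<close> form a basis of the kernel of \<open>X\<close>, with \<open>G\<close> reading off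
  coordinates in it.\<close>
lemma two_grid_exact_iff:
  fixes X Y P Q C C' N G X' :: "'a::field mat"
  assumes car: "X \<in> carrier_mat m n" "Y \<in> carrier_mat m n" "P \<in> carrier_mat n m"
      "Q \<in> carrier_mat n m" "C \<in> carrier_mat m m" "C' \<in> carrier_mat m m"
      "N \<in> carrier_mat n m" "G \<in> carrier_mat m n" "X' \<in> carrier_mat n m"
    and C: "C * (X * P) = 1\<^sub>m m" and C': "C' * (Y * Q) = 1\<^sub>m m"
    and XN: "X * N = 0\<^sub>m m m" and GN: "G * N = 1\<^sub>m m"
    and split: "X' * X + N * G = 1\<^sub>m n"
  shows "P * (C * X) + Q * (C' * Y) * (1\<^sub>m n - P * (C * X)) = 1\<^sub>m n \<longleftrightarrow> X * Q = 0\<^sub>m m m"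
proof -
  \<comment> \<open>For right-hand side \<open>A u\<close>, the first step returns
    \<open>S u\<close>, so \<open>1 - S\<close> propagates the error; \<open>T\<close> is the
    analogous map of the second step, applied to that error.\<close>
  define S T where "S = P * (C * X)" and "T = Q * (C' * Y)"
  have S: "S \<in> carrier_mat n n" and T: "T \<in> carrier_mat n n"
    using car by (auto simp: S_def T_def)
  have E: "1\<^sub>m n - S \<in> carrier_mat n n" using S by (rule minus_carrier_mat)
  note [simp] = carrier_matD[OF car(1)] carrier_matD[OF car(2)] carrier_matD[OF car(3)]
    carrier_matD[OF car(4)] carrier_matD[OF car(5)] carrier_matD[OF car(6)]
    carrier_matD[OF car(7)] carrier_matD[OF car(8)] carrier_matD[OF car(9)]
    carrier_matD[OF S] carrier_matD[OF T] carrier_matD[OF E]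
  \<comment> \<open>Applying the splitting of the identity to \<open>Z\<close> removes the term with
    \<open>X\<close>, so the kernel of \<open>X\<close> lies in the range of
    \<open>N\<close>.\<close>
  have ker: "Z = N * (G * Z)" if Z: "Z \<in> carrier_mat n k" and XZ: "X * Z = 0\<^sub>m m k" for Z k
  proof -
    have "Z = (X' * X + N * G) * Z" using Z by (simp add: split)
    also have "\<dots> = X' * X * Z + N * G * Z"
      by (rule add_mult_distrib_mat[of _ n n _ _ k]) (use Z in auto)
    also have "X' * X * Z = 0\<^sub>m n k"
      using Z car by (simp add: mult_mat_assoc_dims XZ)
    also have "0\<^sub>m n k + N * G * Z = N * G * Z"
      by (rule left_add_zero_mat) (use Z in auto)
    finally show ?thesis using Z by (simp add: mult_mat_assoc_dims)
  qed
  show ?thesis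
  proof
    assume "P * (C * X) + Q * (C' * Y) * (1\<^sub>m n - P * (C * X)) = 1\<^sub>m n"
    then have ST: "S + T * (1\<^sub>m n - S) = 1\<^sub>m n" by (simp add: S_def T_def)
    \<comment> \<open>The first step does not see the kernel of \<open>X\<close>: \<open>S\<close>
      kills \<open>N\<close> and \<open>1 - S\<close> fixes it. Exactness therefore forces
      \<open>N = T * N\<close>, which puts \<open>N\<close> into the range of
      \<open>Q\<close>.\<close>
    have SN: "S * N = 0\<^sub>m n m"
      using car by (simp add: S_def mult_mat_assoc_dims XN)
    have EN: "(1\<^sub>m n - S) * N = N"
    proof -
      have "(1\<^sub>m n - S) * N = 1\<^sub>m n * N - S * N"
        by (rule minus_mult_distrib_mat) (use car S in auto)
      also have "\<dots> = N - 0\<^sub>m n m" using car by (simp add: SN)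
      also have "\<dots> = N" by (rule eq_matI) auto
      finally show ?thesis .
    qed
    have "N = (S + T * (1\<^sub>m n - S)) * N" using car by (simp add: ST)
    also have "\<dots> = S * N + T * (1\<^sub>m n - S) * N"
      by (rule add_mult_distrib_mat[of _ n n _ _ m]) auto
    also have "\<dots> = T * ((1\<^sub>m n - S) * N)"
      unfolding SN
      by (subst left_add_zero_mat[of _ n m]) (auto simp: mult_mat_assoc_dims)
    finally have "N = T * N" unfolding EN .
    also have "T * N = Q * (C' * (Y * N))" by (simp add: T_def mult_mat_assoc_dims)
    finally have N: "N = Q * (C' * (Y * N))" .
    \<comment> \<open>Now \<open>N = Q * K\<close>, and \<open>G * N = 1\<close> makes
      \<open>K\<close> a right inverse of the square matrix \<open>G * Q\<close>, hence a two-sided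
      one. So \<open>Q = N * (G * Q)\<close>: the ranges of \<open>Q\<close> and \<open>N\<close>
      agree, and \<open>X\<close> kills \<open>Q\<close>.\<close>
    define K where "K = C' * (Y * N)"
    have K: "K \<in> carrier_mat m m" using car by (auto simp: K_def)
    have "(G * Q) * K = G * (Q * (C' * (Y * N)))"
      by (simp add: K_def mult_mat_assoc_dims)
    also have "\<dots> = 1\<^sub>m m" by (simp add: GN flip: N)
    finally have KG: "K * (G * Q) = 1\<^sub>m m"
      by (rule mat_mult_left_right_inverse[rotated -1]) (use car K in auto)
    have "Q = Q * (K * (G * Q))" using car by (simp add: KG)
    also have "\<dots> = N * (G * Q)"
      by (subst N) (simp add: K_def mult_mat_assoc_dims)
    finally have "X * Q = X * (N * (G * Q))" by simp
    also have "\<dots> = X * N * (G * Q)" by (simp add: mult_mat_assoc_dims)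
    finally show "X * Q = 0\<^sub>m m m" using car by (simp add: XN)
  next
    assume XQ: "X * Q = 0\<^sub>m m m"
    define K where "K = C' * (Y * N)"
    have K: "K \<in> carrier_mat m m" using car by (auto simp: K_def)
    \<comment> \<open>This time the range of \<open>Q\<close> lies in that of \<open>N\<close> by
      assumption, and solvability of the second coarse system makes \<open>K\<close> the inverse of
      \<open>G * Q\<close>. Hence \<open>T\<close> fixes \<open>N\<close>.\<close>
    have Q: "Q = N * (G * Q)" using ker[OF car(4) XQ] .
    have "K * (G * Q) = C' * (Y * (N * (G * Q)))"
      by (simp add: K_def mult_mat_assoc_dims)
    then have "K * (G * Q) = 1\<^sub>m m" by (simp add: C' flip: Q)
    then have GK: "(G * Q) * K = 1\<^sub>m m"
      by (rule mat_mult_left_right_inverse[rotated -1]) (use car K in auto)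
    have "T * N = Q * K" by (simp add: T_def K_def mult_mat_assoc_dims)
    also have "\<dots> = N * ((G * Q) * K)" using K by (subst Q) (simp add: mult_mat_assoc_dims)
    finally have TN: "T * N = N" using car by (simp add: GK)
    \<comment> \<open>\<open>C\<close> inverts the square matrix \<open>X * P\<close> on both sides,
      which gives \<open>X * S = X\<close> and places the error \<open>E\<close> of the first step
      in the kernel of \<open>X\<close>.\<close>
    have XPC: "X * P * C = 1\<^sub>m m"
      by (rule mat_mult_left_right_inverse[OF _ _ C]) (use car in auto)
    have "X * S = X * P * C * X" by (simp add: S_def mult_mat_assoc_dims)
    then have XS: "X * S = X" using car by (simp add: XPC)
    define E where "E = 1\<^sub>m n - S"
    have E: "E \<in> carrier_mat n n" using \<open>1\<^sub>m n - S \<in> carrier_mat n n\<close> by (simp add: E_def)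
    have XE: "X * E = 0\<^sub>m m n"
    proof -
      have "X * E = X * 1\<^sub>m n - X * S"
        unfolding E_def by (rule mult_minus_distrib_mat) (use car S in auto)
      then show ?thesis using car by (simp add: XS)
    qed
    have E': "E = N * (G * E)" using ker[OF E XE] .
    \<comment> \<open>\<open>T\<close> is the identity on the range of \<open>N\<close>, so the
      second step recovers \<open>E\<close> completely.\<close>
    have "T * E = T * N * (G * E)"
      using E by (subst E') (simp add: mult_mat_assoc_dims)
    then have "T * E = E" by (simp add: TN flip: E')
    then have "S + T * (1\<^sub>m n - S) = 1\<^sub>m n"
      by (auto simp: E_def)
    then show "P * (C * X) + Q * (C' * Y) * (1\<^sub>m n - P * (C * X)) = 1\<^sub>m n"
      by (simp add: S_def T_def)
  qed
qed

section \<open>Diagonal blocks and aliasing patterns\<close>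

text \<open>Evenness lets two blocks of size \<open>n div 2\<close> cover all indices; for odd
  \<open>n\<close> the last row and column would be missed.\<close>

lemma diagonal_mat_eq_blocks:
  assumes "E \<in> carrier_mat n n" "diagonal_mat E" "even n"
  shows "E = four_block_mat (low_block n E) (0\<^sub>m (n div 2) (n div 2))
                (0\<^sub>m (n div 2) (n div 2)) (high_block n E)"
  using assms
  by (intro eq_matI) (auto simp: low_block_def high_block_def diagonal_mat_def elim!: evenE)

lemma low_block_carrier [simp]: "low_block n E \<in> carrier_mat (n div 2) (n div 2)"
  by (simp add: low_block_def)

lemma high_block_carrier [simp]: "high_block n E \<in> carrier_mat (n div 2) (n div 2)"
  by (simp add: high_block_def)

lemma block_diagonal_mult:
  fixes A B C D :: "'a::semiring_0 mat"
  assumes "A \<in> carrier_mat m m" "B \<in> carrier_mat m m" "C \<in> carrier_mat m m" "D \<in> carrier_mat m m"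
  shows "four_block_mat A (0\<^sub>m m m) (0\<^sub>m m m) B * four_block_mat C (0\<^sub>m m m) (0\<^sub>m m m) D =
    four_block_mat (A * C) (0\<^sub>m m m) (0\<^sub>m m m) (B * D)"
  using assms by (subst mult_four_block_mat[of _ m m _ m _ m]) auto

text \<open>Summing blocks on the left and differencing them on the right leaves one quarter of a
  matrix whose four blocks are all \<open>L - H\<close> or \<open>H - L\<close>.\<close>

lemma aliasing_sandwich_eq_0_iff:
  fixes L H :: "complex mat"
  assumes L: "L \<in> carrier_mat m m" and H: "H \<in> carrier_mat m m"
  defines "I \<equiv> 1\<^sub>m m :: complex mat"
  shows "((1 / 2) \<cdot>\<^sub>m four_block_mat I I I I) * four_block_mat L (0\<^sub>m m m) (0\<^sub>m m m) H *
      ((1 / 2) \<cdot>\<^sub>m four_block_mat I (- I) (- I) I) = 0\<^sub>m (m + m) (m + m) \<longleftrightarrow> L = H"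
    (is "?M = _ \<longleftrightarrow> _")
proof -
  have "four_block_mat I I I I * four_block_mat L (0\<^sub>m m m) (0\<^sub>m m m) H = four_block_mat L H L H"
    using L H by (subst mult_four_block_mat[of _ m m _ m _ m]) (auto simp: I_def)
  moreover have "four_block_mat L H L H * four_block_mat I (- I) (- I) I =
      four_block_mat (L - H) (H - L) (L - H) (H - L)"
    using L H
    by (subst mult_four_block_mat[of _ m m _ m _ m])
       (auto simp: I_def minus_add_uminus_mat[of _ m m] comm_add_mat[of _ m m]
             simp flip: uminus_mult_right_mat)
  moreover have "a \<cdot>\<^sub>m (b \<cdot>\<^sub>m Z) = (a * b) \<cdot>\<^sub>m Z" for a b :: complex and Z
    by (rule eq_matI) auto
  ultimately have M: "?M = (1 / 4) \<cdot>\<^sub>m four_block_mat (L - H) (H - L) (L - H) (H - L)"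
    using L H
    by (simp add: I_def mult_smult_assoc_mat[of _ "m + m" "m + m" _ "m + m"]
          mult_smult_distrib[of _ "m + m" "m + m" _ "m + m"])
  show ?thesis
  proof
    assume *: "?M = 0\<^sub>m (m + m) (m + m)"
    show "L = H"
    proof (rule eq_matI)
      fix i j assume "i < dim_row H" "j < dim_col H"
      then show "L $$ (i, j) = H $$ (i, j)"
        using arg_cong[OF *[unfolded M], of "\<lambda>Z. Z $$ (i, j)"] L H by simp
    qed (use L H in auto)
  next
    assume "L = H"
    then show "?M = 0\<^sub>m (m + m) (m + m)"
      unfolding M using L H by (intro eq_matI) auto
  qed
qed

text \<open>A one-sided inverse suffices, so the cancelled factor may be rectangular, as the
  sampling operators in the harmonic basis are.\<close>

lemma mult_left_cancel_0:
  fixes A Z :: "'a::semiring_1 mat"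
  assumes "A' * A = 1\<^sub>m n" "A \<in> carrier_mat m n" "A' \<in> carrier_mat n m" "Z \<in> carrier_mat n k"
  shows "A * Z = 0\<^sub>m m k \<longleftrightarrow> Z = 0\<^sub>m n k"
proof
  assume "A * Z = 0\<^sub>m m k"
  then have "A' * (A * Z) = 0\<^sub>m n k" using assms by simp
  moreover have "A' * (A * Z) = A' * A * Z" using assms(2-) by (simp add: mult_mat_assoc_dims)
  ultimately show "Z = 0\<^sub>m n k" using assms by simp
qed (use assms in simp)

lemma mult_right_cancel_0:
  fixes A Z :: "'a::semiring_1 mat"
  assumes "A * A' = 1\<^sub>m n" "A \<in> carrier_mat n m" "A' \<in> carrier_mat m n" "Z \<in> carrier_mat k n"
  shows "Z * A = 0\<^sub>m k m \<longleftrightarrow> Z = 0\<^sub>m k n"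
proof
  assume *: "Z * A = 0\<^sub>m k m"
  have "Z = Z * (A * A')" using assms by simp
  also have "\<dots> = Z * A * A'" using assms by (simp add: mult_mat_assoc_dims)
  finally show "Z = 0\<^sub>m k n" using assms * by simp
qed (use assms in simp)

section \<open>The harmonic red-black configuration\<close>

theorem theorem4:
  fixes n :: nat
    and A W V \<Lambda> :: "complex mat"
    and R B :: "nat set"
    and PR\<^sub>R PR\<^sub>I PB\<^sub>R PB\<^sub>I FR\<^sub>R FR\<^sub>I FB\<^sub>R FB\<^sub>I :: "complex mat"
  assumes "even n"
    and "harmonic_aliasing n A W V \<Lambda> R B"
    and "diagonalized_by n W V PR\<^sub>R FR\<^sub>R"
    and "diagonalized_by n W V PR\<^sub>I FR\<^sub>I"
    and "diagonalized_by n W V PB\<^sub>R FB\<^sub>R"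
    and "diagonalized_by n W V PB\<^sub>I FB\<^sub>I"
    and "invertible_mat A"
    and "invertible_mat (coarse_mat n R A FR\<^sub>R FR\<^sub>I)"
    and "invertible_mat FR\<^sub>R"
    and "invertible_mat (coarse_mat n B A FB\<^sub>R FB\<^sub>I)"
    and "invertible_mat FB\<^sub>I"
  shows "(\<forall>f \<in> carrier_vec n. \<forall>u \<in> carrier_vec n. A *\<^sub>v u = f \<longrightarrow>
            multiplicative_two_grid n A R FR\<^sub>R FR\<^sub>I B FB\<^sub>R FB\<^sub>I f = u)
         \<longleftrightarrow>
         low_block n PR\<^sub>R * low_block n \<Lambda> * low_block n PB\<^sub>I =
         high_block n PR\<^sub>R * high_block n \<Lambda> * high_block n PB\<^sub>I"
proof -
  define m where "m = n div 2"
  have n: "n = m + m" using \<open>even n\<close> by (auto simp: m_def)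
  define V' where "V' = mat_adjoint V"
  define Dr Db Ur Ub where "Dr = down_sampling n R" and "Db = down_sampling n B"
    and "Ur = up_sampling n R" and "Ub = up_sampling n B"
  note ha = assms(2)[unfolded harmonic_aliasing_def diagonalized_by_def Let_def,
      folded V'_def m_def Dr_def Db_def Ur_def Ub_def]
  note dia = assms(3-6)[unfolded diagonalized_by_def, folded V'_def]
  have W: "W \<in> carrier_mat n n" and V'W: "V' * W = 1\<^sub>m n" using ha by auto
  have V': "V' \<in> carrier_mat n n" using ha by (auto simp: V'_def mat_adjoint_def)
  have WV': "W * V' = 1\<^sub>m n" using mat_mult_left_right_inverse[OF V' W V'W] .
  have sampling: "Dr \<in> carrier_mat m n" "Db \<in> carrier_mat m n" "Ur \<in> carrier_mat n m"
      "Ub \<in> carrier_mat n m"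
    by (auto simp: Dr_def Db_def Ur_def Ub_def m_def)
  have eigs: "\<Lambda> \<in> carrier_mat n n" "PR\<^sub>R \<in> carrier_mat n n" "PB\<^sub>I \<in> carrier_mat n n"
    using ha dia by auto
  have filters: "A \<in> carrier_mat n n" "FR\<^sub>R \<in> carrier_mat n n" "FR\<^sub>I \<in> carrier_mat n n"
      "FB\<^sub>R \<in> carrier_mat n n" "FB\<^sub>I \<in> carrier_mat n n"
    using ha dia W V' by auto
  note [simp] = carrier_matD[OF W] carrier_matD[OF V'] sampling[THEN carrier_matD(1)]
    sampling[THEN carrier_matD(2)] eigs[THEN carrier_matD(1)] eigs[THEN carrier_matD(2)]
    filters[THEN carrier_matD(1)] filters[THEN carrier_matD(2)]

  have "red_black_partition n R B" using ha by simp
  then have DUr: "Dr * Ur = 1\<^sub>m m" and DUb: "Db * Ub = 1\<^sub>m m"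
    unfolding red_black_partition_def Dr_def Db_def Ur_def Ub_def m_def
    by (auto intro!: down_up_sampling)
  have alias_r: "V' * Ur * Dr * W = (1 / 2) \<cdot>\<^sub>m four_block_mat (1\<^sub>m m) (1\<^sub>m m) (1\<^sub>m m) (1\<^sub>m m)"
    and alias_b: "V' * Ub * Db * W =
      (1 / 2) \<cdot>\<^sub>m four_block_mat (1\<^sub>m m) (- 1\<^sub>m m) (- 1\<^sub>m m) (1\<^sub>m m)"
    using ha by auto
  \<comment> \<open>The off-diagonal blocks of the two aliasing patterns cancel and their sum is the
    identity. Undoing the change of basis gives \<open>Ur * Dr + Ub * Db = 1\<close>.\<close>
  have "V' * (Ur * Dr + Ub * Db) * W = V' * Ur * Dr * W + V' * Ub * Db * W"
    using W V' sampling
    by (simp add: mult_add_distrib_mat[of _ n n _ n] add_mult_distrib_mat[of _ n n _ _ n]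
        mult_mat_assoc_dims)
  also have "\<dots> = 1\<^sub>m n"
    unfolding alias_r alias_b n by (rule eq_matI) auto
  finally have "W * (V' * (Ur * Dr + Ub * Db) * W) * V' = W * V'" using W by simp
  then have "W * V' * (Ur * Dr + Ub * Db) * (W * V') = W * V'"
    by (simp add: mult_mat_assoc_dims)
  then have UD: "Ur * Dr + Ub * Db = 1\<^sub>m n"
    using sampling by (simp add: WV' left_mult_one_mat[of _ n n] right_mult_one_mat[of _ n n])
  \<comment> \<open>Multiplying this identity by \<open>Dr\<close> and cancelling \<open>Db\<close>
    through its right inverse \<open>Ub\<close> yields \<open>Dr * Ub = 0\<close>, the disjointness
    of the two grids in matrix form.\<close>
  have "Dr = Dr * (Ur * Dr + Ub * Db)" using sampling by (simp add: UD)
  also have "\<dots> = Dr * Ur * Dr + Dr * Ub * Db"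
    using sampling by (simp add: mult_add_distrib_mat[of _ m n _ n] mult_mat_assoc_dims)
  also have "\<dots> = Dr + Dr * Ub * Db" using sampling by (simp add: DUr)
  finally have eq: "Dr = Dr + Dr * Ub * Db" .
  have "Dr * Ub * Db = 0\<^sub>m m n"
  proof (rule eq_matI)
    fix i j assume "i < dim_row (0\<^sub>m m n :: complex mat)" "j < dim_col (0\<^sub>m m n :: complex mat)"
    then show "(Dr * Ub * Db) $$ (i, j) = 0\<^sub>m m n $$ (i, j)"
      using arg_cong[OF eq, of "\<lambda>Z. Z $$ (i, j)"] sampling by simp
  qed auto
  then have DrUb: "Dr * Ub = 0\<^sub>m m m"
    using mult_right_cancel_0[OF DUb sampling(2,4), of "Dr * Ub" m] sampling by auto

  \<comment> \<open>\<open>A\<close> is absorbed into \<open>X\<close> and \<open>Y\<close> so that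
    the scheme acts on the exact solution \<open>u\<close> instead of
    \<open>f = A u\<close>.\<close>
  define X Y P Q C C' where "X = Dr * FR\<^sub>R * A" and "Y = Db * FB\<^sub>R * A"
    and "P = FR\<^sub>I * Ur" and "Q = FB\<^sub>I * Ub"
    and "C = the (mat_inverse (coarse_mat n R A FR\<^sub>R FR\<^sub>I))"
    and "C' = the (mat_inverse (coarse_mat n B A FB\<^sub>R FB\<^sub>I))"
  note op_defs = coarse_mat_def restriction_op_def interpolation_op_def
  have coarse: "coarse_mat n R A FR\<^sub>R FR\<^sub>I = X * P" "coarse_mat n B A FB\<^sub>R FB\<^sub>I = Y * Q"
    by (simp_all add: op_defs X_def Y_def P_def Q_def Dr_def Db_def Ur_def Ub_def)
  have XYPQ: "X \<in> carrier_mat m n" "Y \<in> carrier_mat m n" "P \<in> carrier_mat n m"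
      "Q \<in> carrier_mat n m"
    by (auto simp: X_def Y_def P_def Q_def)
  have C: "C \<in> carrier_mat m m" "C * (X * P) = 1\<^sub>m m"
    using mat_inverse_invertible[OF assms(8), of m] XYPQ by (auto simp: C_def coarse)
  have C': "C' \<in> carrier_mat m m" "C' * (Y * Q) = 1\<^sub>m m"
    using mat_inverse_invertible[OF assms(10), of m] XYPQ by (auto simp: C'_def coarse)
  note [simp] = XYPQ[THEN carrier_matD(1)] XYPQ[THEN carrier_matD(2)]
    carrier_matD[OF C(1)] carrier_matD[OF C'(1)]

  define T where "T = P * (C * X) + Q * (C' * Y) * (1\<^sub>m n - P * (C * X))"
  have T: "T \<in> carrier_mat n n" by (auto simp: T_def)
  have scheme: "multiplicative_two_grid n A R FR\<^sub>R FR\<^sub>I B FB\<^sub>R FB\<^sub>I (A *\<^sub>v u) = T *\<^sub>v u"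
    if u: "u \<in> carrier_vec n" for u
  proof -
    have [simp]: "dim_vec u = n" using u by auto
    have red: "coarse_solve n R A FR\<^sub>R FR\<^sub>I (A *\<^sub>v x) = P * (C * X) *\<^sub>v x"
      if "x \<in> carrier_vec n" for x
      using that
      by (simp add: coarse_solve_def restriction_op_def interpolation_op_def mult_mat_vec_assoc_dims
          X_def P_def flip: C_def Dr_def Ur_def)
    have black: "coarse_solve n B A FB\<^sub>R FB\<^sub>I (A *\<^sub>v x) = Q * (C' * Y) *\<^sub>v x"
      if "x \<in> carrier_vec n" for x
      using that
      by (simp add: coarse_solve_def restriction_op_def interpolation_op_def mult_mat_vec_assoc_dims
          Y_def Q_def flip: C'_def Db_def Ub_def)
    define S where "S = P * (C * X)"
    have S: "S \<in> carrier_mat n n" by (auto simp: S_def)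
    have Su: "S *\<^sub>v u \<in> carrier_vec n" using S u by simp
    \<comment> \<open>The residual after the red step is \<open>A\<close> applied to the error, so
      the black step also has the form \<open>A *\<^sub>v x\<close>.\<close>
    have "A *\<^sub>v u - A *\<^sub>v (S *\<^sub>v u) = A *\<^sub>v (u - S *\<^sub>v u)"
      using mult_minus_distrib_mat_vec[OF filters(1) u Su] by simp
    moreover have "u - S *\<^sub>v u = (1\<^sub>m n - S) *\<^sub>v u"
      using S u by (simp add: minus_mult_distrib_mat_vec[of _ n n])
    moreover have E: "1\<^sub>m n - S \<in> carrier_mat n n" using S by (rule minus_carrier_mat)
    moreover have "(S + Q * (C' * Y) * (1\<^sub>m n - S)) *\<^sub>v u =
        S *\<^sub>v u + Q * (C' * Y) * (1\<^sub>m n - S) *\<^sub>v u"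
      using S u by (intro add_mult_distrib_mat_vec) (auto simp: carrier_matD[OF E])
    ultimately show ?thesis
      using u carrier_matD[OF S]
      by (simp add: multiplicative_two_grid_def Let_def red black T_def
          mult_mat_vec_assoc_dims[of "Q * (C' * Y)" "1\<^sub>m n - S"] flip: S_def)
  qed
  have "(\<forall>f \<in> carrier_vec n. \<forall>u \<in> carrier_vec n. A *\<^sub>v u = f \<longrightarrow>
            multiplicative_two_grid n A R FR\<^sub>R FR\<^sub>I B FB\<^sub>R FB\<^sub>I f = u) \<longleftrightarrow>
        (\<forall>u\<in>carrier_vec n. T *\<^sub>v u = u)"
    using scheme filters(1) by (metis mult_mat_vec_carrier)
  also have "\<dots> \<longleftrightarrow> T = 1\<^sub>m n" using eq_mat_one_iff_mult_vec[OF T] by simp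
  also have "\<dots> \<longleftrightarrow> X * Q = 0\<^sub>m m m"
  proof -
    obtain A' where A': "A' \<in> carrier_mat n n" "A * A' = 1\<^sub>m n" "A' * A = 1\<^sub>m n"
      using invertible_mat_obtain_inverse[OF assms(7) filters(1)] .
    obtain F' where F': "F' \<in> carrier_mat n n" "FR\<^sub>R * F' = 1\<^sub>m n" "F' * FR\<^sub>R = 1\<^sub>m n"
      using invertible_mat_obtain_inverse[OF assms(9) filters(2)] .
    \<comment> \<open>As \<open>X = Dr * M\<close> with \<open>M\<close> invertible, the grid
      relations carry over: \<open>Dr * Ub = 0\<close> makes \<open>M' * Ub\<close> span the kernel
      of \<open>X\<close>, \<open>Db * M\<close> reads off coordinates, and conjugating
      \<open>Ur * Dr + Ub * Db = 1\<close> by \<open>M\<close> gives the splitting.\<close>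
    define M M' where "M = FR\<^sub>R * A" and "M' = A' * F'"
    have M: "M \<in> carrier_mat n n" "M' \<in> carrier_mat n n"
      using A' F' filters by (auto simp: M_def M'_def)
    have "M * M' = FR\<^sub>R * (A * A') * F'"
      using A'(1) F'(1) by (simp add: M_def M'_def mult_mat_assoc_dims)
    then have MM': "M * M' = 1\<^sub>m n" using A' F' filters by simp
    have M'M: "M' * M = 1\<^sub>m n" using mat_mult_left_right_inverse[OF M MM'] .
    note [simp] = M[THEN carrier_matD(1)] M[THEN carrier_matD(2)]
    have X: "X = Dr * M" by (simp add: X_def M_def mult_mat_assoc_dims)
    have MM'U: "M * (M' * Ub) = Ub"
      using sampling M by (simp flip: mult_mat_assoc_dims add: MM')
    show ?thesis unfolding T_def
    proof (rule two_grid_exact_iff[where N = "M' * Ub" and G = "Db * M" and X' = "M' * Ur"])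
      show "X * (M' * Ub) = 0\<^sub>m m m" by (simp add: X mult_mat_assoc_dims MM'U DrUb)
      show "Db * M * (M' * Ub) = 1\<^sub>m m" by (simp add: mult_mat_assoc_dims MM'U DUb)
      have "M' * Ur * X + M' * Ub * (Db * M) = M' * (Ur * Dr + Ub * Db) * M"
        using sampling M
        by (simp add: X mult_add_distrib_mat[of _ n n _ n] add_mult_distrib_mat[of _ n n _ _ n]
            mult_mat_assoc_dims)
      then show "M' * Ur * X + M' * Ub * (Db * M) = 1\<^sub>m n"
        using M by (simp add: UD M'M)
    qed (use XYPQ C C' sampling M in auto)
  qed
  also have "\<dots> \<longleftrightarrow> low_block n PR\<^sub>R * low_block n \<Lambda> * low_block n PB\<^sub>I =
         high_block n PR\<^sub>R * high_block n \<Lambda> * high_block n PB\<^sub>I" (is "_ \<longleftrightarrow> ?L = ?H")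
  proof -
    define \<Theta> where "\<Theta> = PR\<^sub>R * \<Lambda> * PB\<^sub>I"
    have \<Theta>: "\<Theta> \<in> carrier_mat n n" by (rule carrier_matI) (simp_all add: \<Theta>_def)
    note [simp] = carrier_matD[OF \<Theta>]
    \<comment> \<open>All three factors \<open>FR\<^sub>R\<close>, \<open>A\<close>,
      \<open>FB\<^sub>I\<close> share one eigenbasis, so the inner pairs \<open>V' * W\<close>
      collapse and only the product of their eigenvalue matrices remains.\<close>
    have cancel: "V' * (W * Z) = Z" if "Z \<in> carrier_mat n k" for Z k
      using that by (simp flip: mult_mat_assoc_dims add: V'W)
    have filter_forms: "FR\<^sub>R = W * PR\<^sub>R * V'" "A = W * \<Lambda> * V'" "FB\<^sub>I = W * PB\<^sub>I * V'"
      using ha dia by blast+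
    have XQ: "X * Q = Dr * W * \<Theta> * (V' * Ub)"
    proof -
      have "X * Q = Dr * (W * (PR\<^sub>R * (V' * (W * (\<Lambda> * (V' * (W * (PB\<^sub>I * (V' * Ub)))))))))"
        unfolding X_def Q_def filter_forms by (simp add: mult_mat_assoc_dims)
      also have "\<dots> = Dr * (W * (PR\<^sub>R * (\<Lambda> * (PB\<^sub>I * (V' * Ub)))))"
        by (simp add: cancel[of _ m] carrier_matI)
      finally show ?thesis by (simp add: \<Theta>_def mult_mat_assoc_dims)
    qed
    have "Dr * W * \<Theta> * (V' * Ub) = 0\<^sub>m m m \<longleftrightarrow>
        (V' * Ur) * (Dr * W * \<Theta> * (V' * Ub)) = 0\<^sub>m n m"
    \<comment> \<open>The left inverse \<open>Dr * W\<close> of \<open>V' * Ur\<close> comes from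
      \<open>W * V' = 1\<close> and \<open>Dr * Ur = 1\<close>; on the other side
      \<open>V' * Ub\<close> is a right inverse of \<open>Db * W\<close>. Regrouping then exposes
      the two aliasing patterns around \<open>\<Theta>\<close>.\<close>
    proof (rule mult_left_cancel_0[symmetric, where A' = "Dr * W"])
      have "Dr * W * (V' * Ur) = Dr * (W * V' * Ur)" by (simp add: mult_mat_assoc_dims)
      then show "Dr * W * (V' * Ur) = 1\<^sub>m m" using sampling by (simp add: WV' DUr)
    qed auto
    also have "\<dots> \<longleftrightarrow> (V' * Ur) * (Dr * W * \<Theta> * (V' * Ub)) * (Db * W) = 0\<^sub>m n n"
    proof (rule mult_right_cancel_0[symmetric, where A' = "V' * Ub"])
      have "Db * W * (V' * Ub) = Db * (W * V' * Ub)" by (simp add: mult_mat_assoc_dims)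
      then show "Db * W * (V' * Ub) = 1\<^sub>m m" using sampling by (simp add: WV' DUb)
    qed auto
    also have "(V' * Ur) * (Dr * W * \<Theta> * (V' * Ub)) * (Db * W) =
        (V' * Ur * Dr * W) * \<Theta> * (V' * Ub * Db * W)"
      by (simp add: mult_mat_assoc_dims)
    finally have "X * Q = 0\<^sub>m m m \<longleftrightarrow>
        (V' * Ur * Dr * W) * \<Theta> * (V' * Ub * Db * W) = 0\<^sub>m n n"
      unfolding XQ .
    moreover have \<Theta>_blocks: "\<Theta> = four_block_mat ?L (0\<^sub>m m m) (0\<^sub>m m m) ?H"
    proof -
      have diag: "diagonal_mat PR\<^sub>R" "diagonal_mat \<Lambda>" "diagonal_mat PB\<^sub>I" using ha dia by auto
      have c: "low_block n E \<in> carrier_mat m m" "high_block n E \<in> carrier_mat m m" for E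
        by (simp_all add: m_def)
      let ?block = "\<lambda>E. four_block_mat (low_block n E) (0\<^sub>m m m) (0\<^sub>m m m) (high_block n E)"
      have "\<Theta> = ?block PR\<^sub>R * ?block \<Lambda> * ?block PB\<^sub>I"
        using eigs diag \<open>even n\<close>
        by (simp add: \<Theta>_def diagonal_mat_eq_blocks[of _ n, folded m_def, symmetric])
      then show ?thesis
        by (simp add: block_diagonal_mult c mult_carrier_mat[of _ m m])
    qed
    moreover have "?L \<in> carrier_mat m m" "?H \<in> carrier_mat m m"
      by (auto simp: low_block_def high_block_def m_def)
    ultimately show ?thesis
      using aliasing_sandwich_eq_0_iff[of ?L m ?H] by (simp add: alias_r alias_b flip: n)
  qed
  finally show ?thesis .
qed

end
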